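(* Let $X,Y$ be complex Banach spaces and let $A\in\mathcal{L}(X,Y)$ and $B,C\in\mathcal{L}(Y,X)$ be such that $A(BA)^2=ABACA=ACABA=(AC)^2A$. Then $$\sigma_{dec}(AC)=\sigma_{dec}(BA).$$ In particular, $AC$ is decomposable if and only if $BA$ is decomposable.
   Context: $\mathcal{L}(X,Y)$ is the set of bounded linear operators from $X$ to $Y$, and $\mathcal{L}(X)=\mathcal{L}(X,X)$; $\sigma(T)$ is the spectrum of $T$. An operator $T\in\mathcal{L}(X)$ is decomposable on an open set $U\subseteq\mathbb{C}$ if for every finite open cover $\{U_1,\ldots,U_n\}$ of $\mathbb{C}$ with $\sigma(T)\setminus U\subseteq U_1$, there exist closed $T$-invariant subspaces $X_1,\ldots,X_n$ of $X$ such that $\sigma(T|X_i)\subseteq U_i$ for $i=1,\ldots,n$ and $X_1+\cdots+X_n=X$. $\rho_{dec}(T)$ is the largest open set $U\subseteq\mathbb{C}$ on which $T$ is decomposable (such a largest open set exists), and $\sigma_{dec}(T)=\mathbb{C}\setminus\rho_{dec}(T)$. $T$ is decomposable if $\sigma_{dec}(T)=\emptyset$. *)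

theory Defs
  imports "HOL-Analysis.Analysis"
begin

text \<open>
  A complex Banach space is a real Banach space (library class \<^class>\<open>banach\<close>) whose real
  scalar multiplication extends to a complex one, with the norm homogeneous over the complex
  numbers. The zero space is allowed.
\<close>

class cbanach = banach +
  fixes scaleC :: "complex \<Rightarrow> 'a \<Rightarrow> 'a" (infixr "*\<^sub>C" 75)
  assumes scaleC_add_right: "a *\<^sub>C (x + y) = a *\<^sub>C x + a *\<^sub>C y"
    and scaleC_add_left: "(a + b) *\<^sub>C x = a *\<^sub>C x + b *\<^sub>C x"
    and scaleC_scaleC: "a *\<^sub>C b *\<^sub>C x = (a * b) *\<^sub>C x"
    and scaleC_of_real: "complex_of_real r *\<^sub>C x = r *\<^sub>R x"
    and norm_scaleC: "norm (a *\<^sub>C x) = cmod a * norm x"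

instantiation complex :: cbanach
begin

definition scaleC_complex :: "complex \<Rightarrow> complex \<Rightarrow> complex"
  where "scaleC_complex a x = a * x"

instance
  by standard (simp_all add: scaleC_complex_def algebra_simps norm_mult scaleR_conv_of_real)

end

global_interpretation complex_vector:
  vector_space "scaleC :: complex \<Rightarrow> 'a \<Rightarrow> 'a :: cbanach"
proof
  show "1 *\<^sub>C x = x" for x :: 'a
    using scaleC_of_real[of 1 x] by simp
qed (fact scaleC_add_right scaleC_add_left scaleC_scaleC)+

definition bounded_clinear :: "('a :: cbanach \<Rightarrow> 'b :: cbanach) \<Rightarrow> bool"
  where "bounded_clinear f \<longleftrightarrow> bounded_linear f \<and> (\<forall>c x. f (c *\<^sub>C x) = c *\<^sub>C f x)"

text \<open>
  Closed subspaces are sets rather than types, so an operator on a closed subspace \<open>M\<close> is given by a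
  function of which only the values on \<open>M\<close> matter.
\<close>

definition bounded_operator_on :: "'a :: cbanach set \<Rightarrow> ('a \<Rightarrow> 'a) \<Rightarrow> bool"
  where "bounded_operator_on M S \<longleftrightarrow>
    S ` M \<subseteq> M \<and>
    (\<forall>x\<in>M. \<forall>y\<in>M. S (x + y) = S x + S y) \<and>
    (\<forall>c. \<forall>x\<in>M. S (c *\<^sub>C x) = c *\<^sub>C S x) \<and>
    (\<exists>K. \<forall>x\<in>M. norm (S x) \<le> K * norm x)"

text \<open>
  The spectrum of the restriction \<open>T|M\<close>, for a closed \<open>T\<close>-invariant subspace \<open>M\<close>: the \<open>z\<close> for
  which \<open>z - T|M\<close> has no inverse in the algebra of bounded operators on \<open>M\<close>. It is empty for
  \<open>M = {0}\<close>.
\<close>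

definition spectrum_on :: "'a :: cbanach set \<Rightarrow> ('a \<Rightarrow> 'a) \<Rightarrow> complex set"
  where "spectrum_on M T =
    {z. \<not> (\<exists>S. bounded_operator_on M S \<and>
              (\<forall>x\<in>M. S (z *\<^sub>C x - T x) = x \<and> z *\<^sub>C S x - T (S x) = x))}"

abbreviation spectrum :: "('a :: cbanach \<Rightarrow> 'a) \<Rightarrow> complex set"
  where "spectrum T \<equiv> spectrum_on UNIV T"

definition closed_invariant_subspace :: "('a :: cbanach \<Rightarrow> 'a) \<Rightarrow> 'a set \<Rightarrow> bool"
  where "closed_invariant_subspace T M \<longleftrightarrow>
    complex_vector.subspace M \<and> closed M \<and> T ` M \<subseteq> M"

definition decomposable_on :: "('a :: cbanach \<Rightarrow> 'a) \<Rightarrow> complex set \<Rightarrow> bool"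
  where "decomposable_on T U \<longleftrightarrow>
    (\<forall>(n::nat) V.
      n \<ge> 1 \<and> (\<forall>i\<in>{1..n}. open (V i)) \<and> (\<Union>i\<in>{1..n}. V i) = UNIV \<and>
      spectrum T - U \<subseteq> V 1 \<longrightarrow>
      (\<exists>M. (\<forall>i\<in>{1..n}. closed_invariant_subspace T (M i) \<and> spectrum_on (M i) T \<subseteq> V i) \<and>
           {\<Sum>i\<in>{1..n}. x i | x. \<forall>i\<in>{1..n}. x i \<in> M i} = UNIV))"

text \<open>
  The largest open set, with respect to inclusion, on which \<open>T\<close> is decomposable. That one exists is
  a known fact about bounded operators on complex Banach spaces.
\<close>

definition rho_dec :: "('a :: cbanach \<Rightarrow> 'a) \<Rightarrow> complex set"
  where "rho_dec T = (GREATEST U. open U \<and> decomposable_on T U)"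

definition sigma_dec :: "('a :: cbanach \<Rightarrow> 'a) \<Rightarrow> complex set"
  where "sigma_dec T = UNIV - rho_dec T"

definition decomposable :: "('a :: cbanach \<Rightarrow> 'a) \<Rightarrow> bool"
  where "decomposable T \<longleftrightarrow> sigma_dec T = {}"

end

theory Submission imports Defs
begin

text \<open>
  Put \<open>R = BA\<close> and \<open>S = AC\<close>. The hypotheses say precisely enough about these products that
  \<open>P = ACA\<close> and \<open>Q = BACAC\<close> intertwine them, \<open>PR = SP\<close> and \<open>QS = RQ\<close>, and factor a common power
  of them, \<open>QP = R\<^sup>4\<close> and \<open>PQ = S\<^sup>4\<close>. These four relations are symmetric in the two operators.
  They imply that \<open>R\<close> is decomposable on every set on which \<open>S\<close> is, and hence, by symmetry, that
  the two operators are decomposable on the same sets; equality of the decomposability spectra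
  follows at once (\<open>decomposable_on_transfer\<close>).

  Invariant subspaces are carried from \<open>S\<close> to \<open>R\<close> in two ways. If \<open>0\<close> is not in the spectrum of
  \<open>S|N\<close>, then \<open>S\<^sup>m = PQ\<close> is invertible on \<open>N\<close>, so that \<open>Q\<close> is an isomorphism of \<open>N\<close> onto \<open>Q(N)\<close>
  and \<open>R|Q(N)\<close> is similar to \<open>S|N\<close> (\<open>image_invariant_subspace\<close>). For arbitrary \<open>N\<close> the subspace
  \<open>P\<^sup>-\<^sup>1(N)\<close> is closed and invariant, \<open>P\<close> and \<open>Q\<close> again factor powers of the two restrictions, and
  the spectra differ at most by \<open>0\<close> (\<open>vimage_invariant_subspace\<close>). If the members of a decomposition
  of \<open>Y\<close> all have \<open>0\<close> outside their spectrum, except for one \<open>N\<^sub>j\<close>, then \<open>P\<^sup>-\<^sup>1(N\<^sub>j)\<close> and the \<open>Q(N\<^sub>i)\<close>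
  with \<open>i \<noteq> j\<close> have the sum \<open>X\<close>: write \<open>P x = \<Sum> u\<^sub>i\<close>, lift each \<open>u\<^sub>i\<close> with \<open>i \<noteq> j\<close> through \<open>P\<close> to \<open>Q(N\<^sub>i)\<close>, and
  observe that what remains of \<open>x\<close> is mapped to \<open>u\<^sub>j\<close> (\<open>pull_back_decomposition\<close>).

  It remains to choose, for a cover \<open>V\<close> given for \<open>R\<close>, a cover \<open>W\<close> for \<open>S\<close> of which only one member
  \<open>W\<^sub>j\<close> contains \<open>0\<close>. Removing \<open>0\<close> from the other members achieves this unless \<open>W\<^sub>1\<close> is
  required to contain \<open>0\<close> while \<open>V\<^sub>1\<close> does not. This happens only if \<open>0\<close> lies in the spectrum of \<open>S\<close>
  but not in that of \<open>R\<close>. In that case a small disc around \<open>0\<close> is added to \<open>V\<^sub>1\<close> and its boundary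
  circle is removed. Since \<open>R\<close> is then invertible, a restriction of \<open>R\<close> to a closed invariant
  subspace whose spectrum misses a point of the circle has no spectrum in the disc
  (\<open>exceptional_disc\<close>), and its spectrum falls back into \<open>V\<^sub>1\<close> (\<open>refine_cover\<close>).
\<close>

section \<open>Bounded operators on closed subspaces\<close>

lemma bounded_clinearD:
  assumes "bounded_clinear f"
  shows "f (x + y) = f x + f y" "f (x - y) = f x - f y" "f (c *\<^sub>C x) = c *\<^sub>C f x"
    "f 0 = 0" "f (sum g I) = (\<Sum>i\<in>I. f (g i))" "bounded_linear f" "f (- x) = - f x"
  using assms linear_add[of f] linear_neg[of f] linear_diff[of f] linear_0[of f] linear_sum[of f]
  by (auto simp: bounded_clinear_def bounded_linear.linear)

lemma bounded_clinear_comp: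
  assumes "bounded_clinear f" "bounded_clinear g"
  shows "bounded_clinear (f \<circ> g)"
  using assms bounded_linear_compose[of f g] by (simp add: bounded_clinear_def comp_def)

lemma real_subspace_if_complex_subspace:
  assumes "complex_vector.subspace M"
  shows "subspace M"
proof (rule subspaceI)
  show "c *\<^sub>R x \<in> M" if "x \<in> M" for c x
    using complex_vector.subspace_scale[OF assms that, of "of_real c"] by (simp add: scaleC_of_real)
qed (use assms complex_vector.subspace_0 complex_vector.subspace_add in blast)+

lemma bounded_operator_on_image_mem:
  "bounded_operator_on M S \<Longrightarrow> x \<in> M \<Longrightarrow> S x \<in> M"
  by (auto simp: bounded_operator_on_def)

lemma bounded_operator_on_minus:
  assumes "bounded_operator_on M S" "x \<in> M"
  shows "S (- x) = - S x"
proof -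
  have "S ((- 1) *\<^sub>C x) = (- 1) *\<^sub>C S x"
    using assms unfolding bounded_operator_on_def by blast
  then show ?thesis by simp
qed

lemma bounded_operator_on_bound:
  assumes "bounded_operator_on M S"
  obtains K where "K > 0" "\<And>x. x \<in> M \<Longrightarrow> norm (S x) \<le> K * norm x"
proof -
  from assms obtain K where K: "\<And>x. x \<in> M \<Longrightarrow> norm (S x) \<le> K * norm x"
    unfolding bounded_operator_on_def by blast
  have "norm (S x) \<le> (\<bar>K\<bar> + 1) * norm x" if "x \<in> M" for x
  proof -
    have "K * norm x \<le> (\<bar>K\<bar> + 1) * norm x" by (intro mult_right_mono) auto
    with K[OF that] show ?thesis by linarith
  qed
  then show thesis by (rule that[rotated]) auto
qed

lemma bounded_operator_on_sandwich:
  assumes G: "bounded_operator_on N G" and P: "bounded_clinear P" and Q: "bounded_clinear Q"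
    and PM: "P ` M \<subseteq> N" and QN: "Q ` N \<subseteq> M"
  shows "bounded_operator_on M (\<lambda>x. Q (G (P x)))"
proof -
  obtain K where K: "K > 0" "\<And>x. x \<in> N \<Longrightarrow> norm (G x) \<le> K * norm x"
    using bounded_operator_on_bound[OF G] by blast
  obtain p where p: "\<And>x. norm (P x) \<le> norm x * p"
    using bounded_linear.bounded[OF bounded_clinearD(6)[OF P]] by blast
  obtain q where q: "q > 0" "\<And>x. norm (Q x) \<le> norm x * q"
    using bounded_linear.pos_bounded[OF bounded_clinearD(6)[OF Q]] by blast
  have "norm (Q (G (P x))) \<le> (q * K * p) * norm x" if "x \<in> M" for x
  proof -
    have "norm (Q (G (P x))) \<le> q * norm (G (P x))"
      using q(2)[of "G (P x)"] by (simp add: mult.commute)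
    also have "\<dots> \<le> q * (K * norm (P x))"
      using q(1) K(2)[of "P x"] that PM by (intro mult_left_mono) auto
    also have "\<dots> \<le> q * (K * (norm x * p))"
      using q(1) K(1) p by (intro mult_left_mono) auto
    finally show ?thesis by (simp add: algebra_simps)
  qed
  moreover have "G (x + y) = G x + G y" "G (c *\<^sub>C x) = c *\<^sub>C G x" "G x \<in> N"
    if "x \<in> N" "y \<in> N" for x y c
    using G that by (auto simp: bounded_operator_on_def)
  ultimately show ?thesis
    using PM QN unfolding bounded_operator_on_def
    by (auto simp: bounded_clinearD[OF P] bounded_clinearD[OF Q] image_subset_iff)
qed

lemma bounded_operator_on_comp:
  assumes G: "bounded_operator_on M G" and H: "bounded_operator_on M H"
  shows "bounded_operator_on M (\<lambda>x. G (H x))"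
proof -
  obtain g where g: "g > 0" "\<And>x. x \<in> M \<Longrightarrow> norm (G x) \<le> g * norm x"
    using bounded_operator_on_bound[OF G] by blast
  obtain h where h: "\<And>x. x \<in> M \<Longrightarrow> norm (H x) \<le> h * norm x"
    using bounded_operator_on_bound[OF H] by blast
  have "norm (G (H x)) \<le> (g * h) * norm x" if "x \<in> M" for x
  proof -
    have "norm (G (H x)) \<le> g * norm (H x)"
      using g(2) bounded_operator_on_image_mem[OF H that] by blast
    also have "\<dots> \<le> g * (h * norm x)"
      using g(1) h[OF that] by (intro mult_left_mono) auto
    finally show ?thesis by (simp add: algebra_simps)
  qed
  then show ?thesis
    using G H unfolding bounded_operator_on_def by (auto simp: image_subset_iff)
qed

lemma bounded_operator_on_power:
  assumes "bounded_operator_on M G"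
  shows "bounded_operator_on M (G ^^ n)"
proof (induction n)
  case 0
  have "\<exists>K. \<forall>x\<in>M. norm x \<le> K * norm x" by (rule exI[of _ 1]) simp
  then show ?case by (simp add: bounded_operator_on_def)
next
  case (Suc n)
  from bounded_operator_on_comp[OF assms Suc.IH] show ?case by (simp add: comp_def)
qed

lemma bounded_operator_on_scale:
  assumes "bounded_operator_on M G" "complex_vector.subspace M"
  shows "bounded_operator_on M (\<lambda>x. c *\<^sub>C G x)"
proof -
  obtain g where g: "\<And>x. x \<in> M \<Longrightarrow> norm (G x) \<le> g * norm x"
    using bounded_operator_on_bound[OF assms(1)] by blast
  have "norm (c *\<^sub>C G x) \<le> (cmod c * g) * norm x" if "x \<in> M" for x
    using mult_left_mono[OF g[OF that], of "cmod c"] by (simp add: norm_scaleC mult.assoc)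
  then have "\<exists>K. \<forall>x\<in>M. norm (c *\<^sub>C G x) \<le> K * norm x" by blast
  then show ?thesis
    using assms unfolding bounded_operator_on_def
    by (auto simp: scaleC_add_right scaleC_scaleC mult.commute image_subset_iff
        intro: complex_vector.subspace_scale)
qed

lemma bounded_operator_on_add:
  assumes "bounded_operator_on M G" "bounded_operator_on M H" "complex_vector.subspace M"
  shows "bounded_operator_on M (\<lambda>x. G x + H x)"
proof -
  obtain g where g: "\<And>x. x \<in> M \<Longrightarrow> norm (G x) \<le> g * norm x"
    using bounded_operator_on_bound[OF assms(1)] by blast
  obtain h where h: "\<And>x. x \<in> M \<Longrightarrow> norm (H x) \<le> h * norm x"
    using bounded_operator_on_bound[OF assms(2)] by blast
  have "norm (G x + H x) \<le> (g + h) * norm x" if "x \<in> M" for x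
    using norm_triangle_ineq[of "G x" "H x"] g[OF that] h[OF that] by (simp add: distrib_right)
  then have "\<exists>K. \<forall>x\<in>M. norm (G x + H x) \<le> K * norm x" by blast
  then show ?thesis
    using assms unfolding bounded_operator_on_def
    by (auto simp: scaleC_add_right image_subset_iff algebra_simps
        intro: complex_vector.subspace_add)
qed

lemma bounded_operator_on_restriction:
  assumes "bounded_clinear T" "T ` M \<subseteq> M"
  shows "bounded_operator_on M T"
proof -
  obtain K where "\<And>x. norm (T x) \<le> norm x * K"
    using bounded_linear.bounded[OF bounded_clinearD(6)[OF assms(1)]] by blast
  then have "\<exists>K. \<forall>x\<in>M. norm (T x) \<le> K * norm x" by (metis mult.commute)
  with assms show ?thesis by (simp add: bounded_operator_on_def bounded_clinearD)
qed

lemma funpow_mem: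
  "T ` M \<subseteq> M \<Longrightarrow> x \<in> M \<Longrightarrow> (T ^^ n) x \<in> M"
  by (induction n) auto

lemma spectrum_on_zero_inverse:
  assumes "0 \<notin> spectrum_on M T" and M: "complex_vector.subspace M" and TM: "T ` M \<subseteq> M"
    and T: "bounded_clinear T"
  obtains G where "bounded_operator_on M G" "\<forall>x\<in>M. G (T x) = x \<and> T (G x) = x"
proof -
  obtain H where H: "bounded_operator_on M H" "\<And>x. x \<in> M \<Longrightarrow> H (- T x) = x"
    "\<And>x. x \<in> M \<Longrightarrow> - T (H x) = x"
    using assms(1) by (auto simp: spectrum_on_def)
  show thesis
  proof
    have "bounded_operator_on M (\<lambda>x. (- 1) *\<^sub>C H x)"
      by (rule bounded_operator_on_scale[OF H(1) M])
    then show "bounded_operator_on M (\<lambda>x. - H x)" by simp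
    have "- H (T x) = x" if "x \<in> M" for x
      using bounded_operator_on_minus[OF H(1), of "T x"] TM H(2)[OF that] that by auto
    moreover have "T (- H x) = x" if "x \<in> M" for x
      using H(3)[OF that] by (simp add: bounded_clinearD[OF T])
    ultimately show "\<forall>x\<in>M. - H (T x) = x \<and> T (- H x) = x" by blast
  qed
qed

section \<open>Stability of the resolvent set\<close>

text \<open>
  A Neumann series argument in which the radius is controlled by a lower bound \<open>b\<close> for \<open>w - T\<close> on
  \<open>M\<close>. Such a bound is inherited from the whole space by every subspace, whereas the norm of the
  resolvent of \<open>T|M\<close> is not known in advance. The resolvent equation is solved as a fixed point
  equation, by the contraction principle on the complete set \<open>M\<close>.
\<close>

lemma resolvent_on_stable:
  assumes T: "bounded_clinear T" and inv: "closed_invariant_subspace T M"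
    and w: "w \<notin> spectrum_on M T"
    and below: "\<And>x. x \<in> M \<Longrightarrow> b * norm x \<le> norm (w *\<^sub>C x - T x)"
    and zw: "cmod (z - w) < b"
  shows "z \<notin> spectrum_on M T"
proof -
  have M: "complex_vector.subspace M" "closed M" "\<And>x. x \<in> M \<Longrightarrow> T x \<in> M"
    using inv by (auto simp: closed_invariant_subspace_def)
  obtain G where G: "bounded_operator_on M G"
      "\<And>x. x \<in> M \<Longrightarrow> G (w *\<^sub>C x - T x) = x" "\<And>x. x \<in> M \<Longrightarrow> w *\<^sub>C G x - T (G x) = x"
    using w by (auto simp: spectrum_on_def)
  have b: "b > 0" using zw norm_ge_zero[of "z - w"] by linarith
  define q where "q = cmod (z - w) / b"
  have q: "0 \<le> q" "q < 1" using b zw by (auto simp: q_def)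
  have Gin: "G x \<in> M" if "x \<in> M" for x using bounded_operator_on_image_mem[OF G(1) that] .
  have Gadd: "G (x + y) = G x + G y" and Gscale: "G (c *\<^sub>C x) = c *\<^sub>C G x"
    if "x \<in> M" "y \<in> M" for x y c
    using G(1) that by (auto simp: bounded_operator_on_def)
  have Gbound: "b * norm (G x) \<le> norm x" if "x \<in> M" for x
    using below[OF Gin[OF that]] G(3)[OF that] by simp
  note sub = complex_vector.subspace_add[OF M(1)] complex_vector.subspace_diff[OF M(1)]
    complex_vector.subspace_scale[OF M(1)] complex_vector.subspace_0[OF M(1)]
  have shift: "z *\<^sub>C x - T x = y \<longleftrightarrow> w *\<^sub>C x - T x = y + (w - z) *\<^sub>C x" for x y
    by (auto simp: complex_vector.scale_left_diff_distrib algebra_simps)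
  have equation_iff_fixed:
    "z *\<^sub>C x - T x = y \<longleftrightarrow> G (y + (w - z) *\<^sub>C x) = x" if "x \<in> M" "y \<in> M" for x y
  proof
    assume "z *\<^sub>C x - T x = y"
    then have "w *\<^sub>C x - T x = y + (w - z) *\<^sub>C x" by (simp add: shift)
    with G(2)[OF that(1)] show "G (y + (w - z) *\<^sub>C x) = x" by simp
  next
    assume "G (y + (w - z) *\<^sub>C x) = x"
    with G(3)[of "y + (w - z) *\<^sub>C x"] that sub show "z *\<^sub>C x - T x = y"
      by (simp add: shift)
  qed
  have unique: "\<exists>!x. x \<in> M \<and> z *\<^sub>C x - T x = y" if y: "y \<in> M" for y
  proof -
    have "\<exists>!x. x \<in> M \<and> G (y + (w - z) *\<^sub>C x) = x"
    proof (rule Banach_fix[of M q])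
      show "complete M" using M(2) by (simp add: complete_eq_closed)
      show "M \<noteq> {}" using sub(4) by blast
      show "(\<lambda>x. G (y + (w - z) *\<^sub>C x)) ` M \<subseteq> M" using Gin sub y by auto
      show "dist (G (y + (w - z) *\<^sub>C x)) (G (y + (w - z) *\<^sub>C x')) \<le> q * dist x x'"
        if "x \<in> M" "x' \<in> M" for x x'
      proof -
        have split: "y + (w - z) *\<^sub>C x = (w - z) *\<^sub>C (x - x') + (y + (w - z) *\<^sub>C x')"
          by (simp add: complex_vector.scale_right_diff_distrib)
        have "G (y + (w - z) *\<^sub>C x) - G (y + (w - z) *\<^sub>C x') = (w - z) *\<^sub>C G (x - x')"
          unfolding split using that y sub by (simp add: Gadd Gscale)
        then have "b * dist (G (y + (w - z) *\<^sub>C x)) (G (y + (w - z) *\<^sub>C x'))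
          = cmod (z - w) * (b * norm (G (x - x')))"
          by (simp add: dist_norm norm_scaleC norm_minus_commute)
        also have "\<dots> \<le> cmod (z - w) * norm (x - x')"
          using Gbound[of "x - x'"] that sub by (intro mult_left_mono) auto
        finally show ?thesis
          using b by (simp add: q_def dist_norm field_simps)
      qed
    qed (use q in auto)
    then show ?thesis using equation_iff_fixed[OF _ y] by (simp cong: conj_cong)
  qed
  define H where "H y = (THE x. x \<in> M \<and> z *\<^sub>C x - T x = y)" for y
  have H: "H y \<in> M \<and> z *\<^sub>C H y - T (H y) = y" if "y \<in> M" for y
    unfolding H_def by (rule theI'[OF unique[OF that]])
  have H_eqI: "H y = x" if "x \<in> M" "z *\<^sub>C x - T x = y" "y \<in> M" for x y
    using unique[OF that(3)] H[OF that(3)] that by blast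
  have "norm (H y) \<le> 1 / (b - cmod (z - w)) * norm y" if "y \<in> M" for y
  proof -
    have "b * norm (H y) \<le> norm (w *\<^sub>C H y - T (H y))" using below H that by blast
    also have "w *\<^sub>C H y - T (H y) = y + (w - z) *\<^sub>C H y" using H[OF that] shift by blast
    also have "norm (y + (w - z) *\<^sub>C H y) \<le> norm y + cmod (z - w) * norm (H y)"
      using norm_triangle_ineq[of y "(w - z) *\<^sub>C H y"]
      by (simp add: norm_scaleC norm_minus_commute)
    finally show ?thesis using zw by (simp add: field_simps)
  qed
  moreover have "H (x + y) = H x + H y" "H (c *\<^sub>C x) = c *\<^sub>C H x" if "x \<in> M" "y \<in> M" for x y c
  proof -
    have "z *\<^sub>C (H x + H y) - T (H x + H y) = (z *\<^sub>C H x - T (H x)) + (z *\<^sub>C H y - T (H y))"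
      by (simp add: bounded_clinearD[OF T] scaleC_add_right)
    then show "H (x + y) = H x + H y" using H that sub by (intro H_eqI) auto
    have "z *\<^sub>C (c *\<^sub>C H x) - T (c *\<^sub>C H x) = c *\<^sub>C (z *\<^sub>C H x - T (H x))"
      by (simp add: bounded_clinearD[OF T] scaleC_scaleC complex_vector.scale_right_diff_distrib mult.commute)
    then show "H (c *\<^sub>C x) = c *\<^sub>C H x" using H that sub by (intro H_eqI) auto
  qed
  ultimately have "bounded_operator_on M H"
    using H unfolding bounded_operator_on_def by blast
  moreover have "H (z *\<^sub>C x - T x) = x" if "x \<in> M" for x
    using that M(3) sub by (intro H_eqI) auto
  ultimately show ?thesis using H by (auto simp: spectrum_on_def)
qed


text \<open>
  The spectrum of a restriction can exceed that of the operator only by filling entire holes, that is,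
  bounded components of the resolvent set. Only the following instance is needed: near a point
  of the resolvent set a hole cannot be filled in part. If \<open>T\<close> is bounded below by \<open>4\<delta>\<close>, as an invertible operator is for small \<open>\<delta>\<close>, then
  \<open>w - T\<close> is bounded below by \<open>3\<delta>\<close> for \<open>w\<close> on the circle of radius \<open>\<delta>\<close>, and every point of the
  disc has distance at most \<open>2\<delta>\<close> from \<open>w\<close>. One resolvent point of \<open>T|M\<close> on the circle therefore
  makes the whole disc a part of the resolvent set of \<open>T|M\<close>.
\<close>

lemma exceptional_disc:
  assumes T: "bounded_clinear T" and zero: "0 \<notin> spectrum T" and r: "r > 0"
  obtains \<delta> where "0 < \<delta>" "\<delta> < r" "sphere 0 \<delta> \<inter> spectrum T = {}"
    "\<forall>M. closed_invariant_subspace T M \<and> \<not> sphere 0 \<delta> \<subseteq> spectrum_on M T \<longrightarrow>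
      cball 0 \<delta> \<inter> spectrum_on M T = {}"
proof -
  have X: "closed_invariant_subspace T UNIV"
    by (simp add: closed_invariant_subspace_def)
  obtain K where K: "bounded_operator_on UNIV K" "\<forall>x\<in>UNIV. K (T x) = x \<and> T (K x) = x"
    by (rule spectrum_on_zero_inverse[OF zero complex_vector.subspace_UNIV subset_UNIV T])
  obtain k where k: "k > 0" "\<And>x. norm (K x) \<le> k * norm x"
    using bounded_operator_on_bound[OF K(1)] by auto
  define \<delta> where "\<delta> = min (r / 2) (1 / (4 * k))"
  have \<delta>: "0 < \<delta>" "\<delta> < r" using r k(1) by (auto simp: \<delta>_def)
  have below0: "4 * \<delta> * norm x \<le> norm (T x)" for x
  proof -
    have "norm x \<le> k * norm (T x)" using k(2)[of "T x"] K(2) by simp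
    moreover have "4 * \<delta> * k \<le> 1"
      using k(1) mult_right_mono[of \<delta> "1 / (4 * k)" "4 * k"] by (simp add: \<delta>_def algebra_simps)
    ultimately have "4 * \<delta> * norm x \<le> 4 * \<delta> * (k * norm (T x))"
      using \<delta>(1) by (intro mult_left_mono) auto
    also have "\<dots> \<le> 1 * norm (T x)"
      using mult_right_mono[OF \<open>4 * \<delta> * k \<le> 1\<close>, of "norm (T x)"] by (simp add: mult.assoc)
    finally show ?thesis by simp
  qed
  have below: "3 * \<delta> * norm x \<le> norm (w *\<^sub>C x - T x)" if "cmod w = \<delta>" for w x
    using norm_triangle_ineq2[of "T x" "w *\<^sub>C x"] below0[of x] that
    by (simp add: norm_scaleC norm_minus_commute algebra_simps)
  show thesis
  proof (rule that[OF \<delta>])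
    have "z \<notin> spectrum T" if "cmod z = \<delta>" for z
      using resolvent_on_stable[OF T X zero, of "4 * \<delta>" z] below0 \<delta>(1) that by simp
    then show "sphere 0 \<delta> \<inter> spectrum T = {}" by auto
  next
    show "\<forall>M. closed_invariant_subspace T M \<and> \<not> sphere 0 \<delta> \<subseteq> spectrum_on M T \<longrightarrow>
      cball 0 \<delta> \<inter> spectrum_on M T = {}"
    proof (intro allI impI, elim conjE)
      fix M assume M: "closed_invariant_subspace T M" "\<not> sphere 0 \<delta> \<subseteq> spectrum_on M T"
      then obtain w where "w \<in> sphere 0 \<delta>" and w: "w \<notin> spectrum_on M T" by blast
      then have norm_w: "cmod w = \<delta>" by simp
      have "z \<notin> spectrum_on M T" if "cmod z \<le> \<delta>" for z
        using resolvent_on_stable[OF T M(1) w, of "3 * \<delta>" z] below[OF norm_w] that norm_w \<delta>(1)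
          norm_triangle_ineq4[of z w] by auto
      then show "cball 0 \<delta> \<inter> spectrum_on M T = {}" by auto
    qed
  qed
qed

section \<open>Operators that factor a common power through each other\<close>

text \<open>
  For \<open>m = 1\<close> this is the classical pair \<open>QP\<close>, \<open>PQ\<close>, whose spectra agree away from \<open>0\<close>. A general
  exponent costs only a geometric sum in the resolvent formula.
\<close>

locale power_factorization =
  fixes R :: "'x::cbanach \<Rightarrow> 'x" and S :: "'y::cbanach \<Rightarrow> 'y"
    and P :: "'x \<Rightarrow> 'y" and Q :: "'y \<Rightarrow> 'x" and m :: nat
  assumes bounded: "bounded_clinear R" "bounded_clinear S" "bounded_clinear P" "bounded_clinear Q"
    and PR: "P (R x) = S (P x)" and QS: "Q (S y) = R (Q y)"
    and QP: "Q (P x) = (R ^^ m) x" and PQ: "P (Q y) = (S ^^ m) y"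

lemma power_factorization_swap:
  "power_factorization R S P Q m \<Longrightarrow> power_factorization S R Q P m"
  by (simp add: power_factorization_def)

text \<open>
  The operator \<open>F\<close> is the sum of \<open>z\<^sup>i T\<^sup>k\<close> over all \<open>i + k = m - 1\<close>, the cofactor of \<open>z - T\<close> in \<open>z\<^sup>m - T\<^sup>m\<close>;
  it is built up by the recursion \<open>F\<^sub>m\<^sub>+\<^sub>1 = z\<^sup>m + T F\<^sub>m\<close>.
\<close>

lemma geometric_cofactor:
  assumes T: "bounded_clinear T" and M: "complex_vector.subspace M" "T ` M \<subseteq> M"
  shows "\<exists>F. bounded_operator_on M F \<and> (\<forall>x\<in>M.
    F (z *\<^sub>C x - T x) = z ^ m *\<^sub>C x - (T ^^ m) x \<and> z *\<^sub>C F x - T (F x) = z ^ m *\<^sub>C x - (T ^^ m) x)"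
proof (induction m)
  case 0
  have "bounded_operator_on M (\<lambda>x. 0 *\<^sub>C (T ^^ 0) x)"
    by (intro bounded_operator_on_scale bounded_operator_on_power bounded_operator_on_restriction T M)
  then show ?case by (intro exI[of _ "\<lambda>x. 0"]) (simp add: bounded_clinearD[OF T])
next
  case (Suc m)
  then obtain F where F: "bounded_operator_on M F"
    "\<And>x. x \<in> M \<Longrightarrow> F (z *\<^sub>C x - T x) = z ^ m *\<^sub>C x - (T ^^ m) x"
    "\<And>x. x \<in> M \<Longrightarrow> z *\<^sub>C F x - T (F x) = z ^ m *\<^sub>C x - (T ^^ m) x" by blast
  have TM: "bounded_operator_on M T" by (rule bounded_operator_on_restriction[OF T M(2)])
  show ?case
  proof (intro exI[of _ "\<lambda>x. z ^ m *\<^sub>C x + T (F x)"] conjI ballI)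
    have "bounded_operator_on M (\<lambda>x. z ^ m *\<^sub>C (T ^^ 0) x + T (F x))"
      by (intro bounded_operator_on_add bounded_operator_on_scale bounded_operator_on_power
          bounded_operator_on_comp[OF TM F(1)] TM M)
    then show "bounded_operator_on M (\<lambda>x. z ^ m *\<^sub>C x + T (F x))" by simp
  next
    fix x assume x: "x \<in> M"
    show "z ^ m *\<^sub>C (z *\<^sub>C x - T x) + T (F (z *\<^sub>C x - T x)) = z ^ Suc m *\<^sub>C x - (T ^^ Suc m) x"
      by (simp add: F(2)[OF x] bounded_clinearD[OF T] complex_vector.scale_right_diff_distrib
          mult.commute)
    have "z *\<^sub>C (z ^ m *\<^sub>C x + T (F x)) - T (z ^ m *\<^sub>C x + T (F x))
      = z ^ Suc m *\<^sub>C x - z ^ m *\<^sub>C T x + T (z *\<^sub>C F x - T (F x))"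
      by (simp add: bounded_clinearD[OF T] scaleC_add_right)
    also have "\<dots> = z ^ Suc m *\<^sub>C x - (T ^^ Suc m) x"
      by (simp add: F(3)[OF x] bounded_clinearD[OF T])
    finally show "z *\<^sub>C (z ^ m *\<^sub>C x + T (F x)) - T (z ^ m *\<^sub>C x + T (F x))
      = z ^ Suc m *\<^sub>C x - (T ^^ Suc m) x" .
  qed
qed

context power_factorization
begin

text \<open>
  For \<open>z \<noteq> 0\<close> the resolvent \<open>G\<close> of \<open>S|N\<close> gives that of \<open>R|M\<close> in closed form, with \<open>F\<close> the geometric
  cofactor: \<open>(z - R) Q G P = Q P = R\<^sup>m\<close> because \<open>P\<close> and \<open>Q\<close> intertwine, and \<open>(z - R) F = z\<^sup>m - R\<^sup>m\<close>,
  so that \<open>Q G P + F\<close> inverts \<open>z - R\<close> up to the scalar \<open>z\<^sup>m\<close>.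
\<close>

lemma spectrum_on_subset:
  assumes M: "complex_vector.subspace M" "R ` M \<subseteq> M" and N: "S ` N \<subseteq> N"
    and PM: "P ` M \<subseteq> N" and QN: "Q ` N \<subseteq> M"
  shows "spectrum_on M R \<subseteq> spectrum_on N S \<union> {0}"
proof -
  have "z \<notin> spectrum_on M R" if z: "z \<noteq> 0" "z \<notin> spectrum_on N S" for z
  proof -
    obtain G where G: "bounded_operator_on N G"
      "\<And>y. y \<in> N \<Longrightarrow> G (z *\<^sub>C y - S y) = y" "\<And>y. y \<in> N \<Longrightarrow> z *\<^sub>C G y - S (G y) = y"
      using z(2) by (auto simp: spectrum_on_def)
    obtain F where F: "bounded_operator_on M F"
      "\<And>x. x \<in> M \<Longrightarrow> F (z *\<^sub>C x - R x) = z ^ m *\<^sub>C x - (R ^^ m) x"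
      "\<And>x. x \<in> M \<Longrightarrow> z *\<^sub>C F x - R (F x) = z ^ m *\<^sub>C x - (R ^^ m) x"
      using geometric_cofactor[OF bounded(1) M] by blast
    define E where "E x = inverse (z ^ m) *\<^sub>C (Q (G (P x)) + F x)" for x
    have E: "bounded_operator_on M E"
      unfolding E_def
      by (intro bounded_operator_on_scale bounded_operator_on_add F(1) M
          bounded_operator_on_sandwich[OF G(1) bounded(3,4) PM QN])
    have cancel: "inverse (z ^ m) *\<^sub>C z ^ m *\<^sub>C x = x" for x :: 'x
    proof -
      have "inverse (z ^ m) * z ^ m = 1" using z(1) by (intro left_inverse) simp
      then show ?thesis unfolding scaleC_scaleC by (simp only: complex_vector.scale_one)
    qed
    have left: "E (z *\<^sub>C x - R x) = x" if x: "x \<in> M" for x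
    proof -
      have "G (P (z *\<^sub>C x - R x)) = P x"
        using G(2)[of "P x"] x PM by (auto simp: bounded_clinearD[OF bounded(3)] PR)
      then show ?thesis by (simp add: E_def F(2)[OF x] QP cancel del: complex_vector.scale_scale)
    qed
    have right: "z *\<^sub>C E x - R (E x) = x" if x: "x \<in> M" for x
    proof -
      have "z *\<^sub>C Q (G (P x)) - R (Q (G (P x))) = Q (z *\<^sub>C G (P x) - S (G (P x)))"
        by (simp add: bounded_clinearD[OF bounded(4)] QS)
      also have "\<dots> = (R ^^ m) x" using G(3)[of "P x"] x PM QP by auto
      finally have QGP: "z *\<^sub>C Q (G (P x)) - R (Q (G (P x))) = (R ^^ m) x" .
      have "z *\<^sub>C E x - R (E x) = inverse (z ^ m) *\<^sub>C
        ((z *\<^sub>C Q (G (P x)) - R (Q (G (P x)))) + (z *\<^sub>C F x - R (F x)))"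
        by (simp add: E_def bounded_clinearD[OF bounded(1)] algebra_simps scaleC_add_right
            complex_vector.scale_right_diff_distrib)
      then show ?thesis by (simp add: QGP F(3)[OF x] cancel del: complex_vector.scale_scale)
    qed
    show ?thesis using E left right by (auto simp: spectrum_on_def)
  qed
  then show ?thesis by blast
qed

lemma vimage_invariant_subspace:
  assumes N: "closed_invariant_subspace S N"
  shows "closed_invariant_subspace R (P -` N)"
    and "spectrum_on (P -` N) R \<subseteq> spectrum_on N S \<union> {0}"
proof -
  have sub: "complex_vector.subspace N" and closed: "closed N" and inv: "S ` N \<subseteq> N"
    using N by (auto simp: closed_invariant_subspace_def)
  have "complex_vector.subspace (P -` N)"
    using sub by (auto simp: complex_vector.subspace_def bounded_clinearD[OF bounded(3)])
  moreover have "closed (P -` N)"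
    using bounded_clinearD(6)[OF bounded(3)] closed
    by (intro continuous_closed_vimage) (simp_all add: linear_continuous_at)
  ultimately show M: "closed_invariant_subspace R (P -` N)"
    using inv by (auto simp: closed_invariant_subspace_def PR)
  have "Q ` N \<subseteq> P -` N"
    using funpow_mem[OF inv] by (auto simp: PQ)
  with M inv show "spectrum_on (P -` N) R \<subseteq> spectrum_on N S \<union> {0}"
    by (intro spectrum_on_subset) (auto simp: closed_invariant_subspace_def)
qed

text \<open>
  With \<open>G\<close> the inverse of \<open>S|N\<close>, the operator \<open>G\<^sup>m P\<close> is a bounded left inverse of \<open>Q\<close> on \<open>N\<close>. Hence
  \<open>Q\<close> is bounded below there, which makes \<open>Q(N)\<close> complete, and \<open>R\<close> on \<open>Q(N)\<close> is inverted by
  \<open>Q G\<^sup>m\<^sup>+\<^sup>1 P\<close>.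
\<close>

lemma image_invariant_subspace:
  assumes N: "closed_invariant_subspace S N" and zero: "0 \<notin> spectrum_on N S"
  shows "closed_invariant_subspace R (Q ` N)"
    and "spectrum_on (Q ` N) R \<subseteq> spectrum_on N S"
    and "P ` Q ` N = N"
proof -
  have sub: "complex_vector.subspace N" and closed: "closed N" and inv: "S ` N \<subseteq> N"
    using N by (auto simp: closed_invariant_subspace_def)
  obtain G where G: "bounded_operator_on N G" and G_inv: "\<forall>y\<in>N. G (S y) = y \<and> S (G y) = y"
    by (rule spectrum_on_zero_inverse[OF zero sub inv bounded(2)])
  have GS: "G (S y) = y" and SG: "S (G y) = y" if "y \<in> N" for y using G_inv that by auto
  have Gk: "bounded_operator_on N (G ^^ k)" for k
    by (rule bounded_operator_on_power[OF G])
  have Gpow: "(G ^^ k) ((S ^^ k) y) = y" if "y \<in> N" for k y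
  proof (induction k)
    case (Suc k)
    then show ?case
      using GS[OF funpow_mem[OF inv that]] by (simp add: funpow_swap1)
  qed simp
  have Spow: "(S ^^ k) ((G ^^ k) y) = y" if "y \<in> N" for k y
  proof (induction k)
    case (Suc k)
    then show ?case
      using SG[OF bounded_operator_on_image_mem[OF Gk that]] by (simp add: funpow_swap1)
  qed simp
  obtain c where c: "c > 0" "\<And>y. y \<in> N \<Longrightarrow> norm ((G ^^ m) y) \<le> c * norm y"
    using bounded_operator_on_bound[OF Gk] by blast
  obtain p where p: "p > 0" "\<And>x. norm (P x) \<le> norm x * p"
    using bounded_linear.pos_bounded[OF bounded_clinearD(6)[OF bounded(3)]] by blast
  have below: "inverse (c * p) * norm y \<le> norm (Q y)" if "y \<in> N" for y
  proof -
    have "norm y \<le> c * norm (P (Q y))"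
      using c(2)[OF funpow_mem[OF inv that, of m]] by (simp add: Gpow[OF that] PQ)
    also have "\<dots> \<le> c * (norm (Q y) * p)"
      using c(1) p(2) by (intro mult_left_mono) auto
    finally show ?thesis using c(1) p(1) by (simp add: field_simps)
  qed
  have "complete (Q ` N)"
    using c(1) p(1) closed
    by (intro complete_isometric_image[OF _ real_subspace_if_complex_subspace[OF sub]
          bounded_clinearD(6)[OF bounded(4)] ballI[OF below]])
      (simp_all add: complete_eq_closed)
  then have QN_closed: "closed (Q ` N)" by (simp add: complete_eq_closed)
  have QN_sub: "complex_vector.subspace (Q ` N)"
  proof -
    have "Q x + Q y \<in> Q ` N" "c *\<^sub>C Q x \<in> Q ` N" if "x \<in> N" "y \<in> N" for x y c
      using that complex_vector.subspace_add[OF sub] complex_vector.subspace_scale[OF sub]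
      by (auto simp flip: bounded_clinearD(1,3)[OF bounded(4)])
    moreover have "0 \<in> Q ` N"
      using complex_vector.subspace_0[OF sub] bounded_clinearD(4)[OF bounded(4)] by force
    ultimately show ?thesis by (auto simp: complex_vector.subspace_def)
  qed
  have QN_inv: "R ` Q ` N \<subseteq> Q ` N" using inv by (auto simp flip: QS)
  show "closed_invariant_subspace R (Q ` N)"
    using QN_sub QN_closed QN_inv by (simp add: closed_invariant_subspace_def)
  have PQN: "P (Q y) \<in> N" if "y \<in> N" for y
    using funpow_mem[OF inv that] by (simp add: PQ)
  show "P ` Q ` N = N"
  proof
    show "N \<subseteq> P ` Q ` N"
    proof
      fix y assume y: "y \<in> N"
      then have "y = P (Q ((G ^^ m) y))" by (simp add: PQ Spow)
      then show "y \<in> P ` Q ` N" using bounded_operator_on_image_mem[OF Gk y] by blast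
    qed
  qed (use PQN in blast)
  have "0 \<notin> spectrum_on (Q ` N) R"
  proof -
    have neg: "(- 1) *\<^sub>C x = - x" for x :: 'x
      by (rule complex_vector.scale_minus_left[of 1 x, simplified complex_vector.scale_one])
    \<comment> \<open>The sign turns the inverse of \<open>R\<close> into the resolvent \<open>(0 - R)\<^sup>-\<^sup>1\<close>.\<close>
    define H where "H x = (- 1) *\<^sub>C Q ((G ^^ Suc m) (P x))" for x
    have "bounded_operator_on (Q ` N) H"
      unfolding H_def
      by (intro bounded_operator_on_scale QN_sub
          bounded_operator_on_sandwich[OF Gk bounded(3,4)]) (use PQN in auto)
    moreover have HQ: "H (Q y) = - Q (G y)" if "y \<in> N" for y
      by (simp add: H_def PQ Gpow[OF that] neg)
    moreover have "H (- R (Q y)) = Q y" "- R (H (Q y)) = Q y" if y: "y \<in> N" for y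
    proof -
      have Sy: "- S y \<in> N" using inv y complex_vector.subspace_neg[OF sub] by blast
      have "- R (Q y) = Q (- S y)"
        using bounded_clinearD(3)[OF bounded(4), of "- 1" "S y"] by (simp add: QS)
      moreover have "G (- S y) = - y"
        using bounded_operator_on_minus[OF G, of "S y"] inv y GS[OF y] by auto
      ultimately show "H (- R (Q y)) = Q y"
        using HQ[OF Sy] bounded_clinearD(3)[OF bounded(4), of "- 1" y] by simp
      have "R (- Q (G y)) = - R (Q (G y))"
        using bounded_clinearD(3)[OF bounded(1), of "- 1" "Q (G y)"] by simp
      then show "- R (H (Q y)) = Q y"
        using HQ[OF y] SG[OF y] by (simp flip: QS)
    qed
    ultimately show ?thesis by (auto simp: spectrum_on_def)
  qed
  moreover have "spectrum_on (Q ` N) R \<subseteq> spectrum_on N S \<union> {0}"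
    by (rule spectrum_on_subset[OF QN_sub QN_inv inv]) (use PQN in auto)
  ultimately show "spectrum_on (Q ` N) R \<subseteq> spectrum_on N S" by blast
qed

section \<open>Decompositions and covers\<close>

lemma pull_back_decomposition:
  assumes I: "finite I" "j \<in> I"
    and N: "\<And>i. i \<in> I \<Longrightarrow> closed_invariant_subspace S (N i)"
    and zero: "\<And>i. i \<in> I - {j} \<Longrightarrow> 0 \<notin> spectrum_on (N i) S"
    and sum_N: "\<And>y. \<exists>u. (\<forall>i\<in>I. u i \<in> N i) \<and> y = (\<Sum>i\<in>I. u i)"
  obtains M where "\<forall>i\<in>I. closed_invariant_subspace R (M i)"
    "\<forall>i\<in>I - {j}. spectrum_on (M i) R \<subseteq> spectrum_on (N i) S"
    "spectrum_on (M j) R \<subseteq> spectrum_on (N j) S \<union> {0}"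
    "\<forall>x. \<exists>v. (\<forall>i\<in>I. v i \<in> M i) \<and> x = (\<Sum>i\<in>I. v i)"
proof
  define M where "M i = (if i = j then P -` N i else Q ` N i)" for i
  show "\<forall>i\<in>I. closed_invariant_subspace R (M i)"
    using vimage_invariant_subspace(1)[OF N] image_invariant_subspace(1)[OF N zero]
    by (auto simp: M_def)
  show "\<forall>i\<in>I - {j}. spectrum_on (M i) R \<subseteq> spectrum_on (N i) S"
    using image_invariant_subspace(2)[OF N zero] by (auto simp: M_def)
  show "spectrum_on (M j) R \<subseteq> spectrum_on (N j) S \<union> {0}"
    using I vimage_invariant_subspace(2)[OF N] by (simp add: M_def)
  show "\<forall>x. \<exists>v. (\<forall>i\<in>I. v i \<in> M i) \<and> x = (\<Sum>i\<in>I. v i)"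
  proof
    fix x
    obtain u where u: "\<And>i. i \<in> I \<Longrightarrow> u i \<in> N i" "P x = (\<Sum>i\<in>I. u i)"
      using sum_N by blast
    have "\<forall>i\<in>I - {j}. \<exists>v. v \<in> Q ` N i \<and> P v = u i"
    proof
      fix i assume i: "i \<in> I - {j}"
      then have "P ` Q ` N i = N i" using image_invariant_subspace(3)[OF N zero, of i] by simp
      then have "u i \<in> P ` Q ` N i" using u(1) i by simp
      then obtain v where "u i = P v" "v \<in> Q ` N i" by (rule imageE)
      then show "\<exists>v. v \<in> Q ` N i \<and> P v = u i" by (intro exI[of _ v]) simp
    qed
    then have "\<exists>v. \<forall>i\<in>I - {j}. v i \<in> Q ` N i \<and> P (v i) = u i" by (rule bchoice)
    then obtain v where v_all: "\<forall>i\<in>I - {j}. v i \<in> Q ` N i \<and> P (v i) = u i" by (rule exE)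
    have v: "v i \<in> Q ` N i" "P (v i) = u i" if "i \<in> I - {j}" for i
      using v_all that by blast+
    \<comment> \<open>Subtracting the lifts of all \<open>u\<^sub>i\<close> with \<open>i \<noteq> j\<close> from \<open>x\<close> leaves a vector that \<open>P\<close> maps to \<open>u\<^sub>j\<close>.\<close>
    define v' where "v' = v(j := x - (\<Sum>i\<in>I - {j}. v i))"
    have rest: "(\<Sum>i\<in>I - {j}. v' i) = (\<Sum>i\<in>I - {j}. v i)" by (rule sum.cong) (auto simp: v'_def)
    have "P (v' j) = P x - (\<Sum>i\<in>I - {j}. u i)"
      by (simp add: v'_def bounded_clinearD[OF bounded(3)] v(2))
    also have "\<dots> = u j" using sum.remove[OF I, of u] u(2) by simp
    finally have "v' j \<in> M j" using u(1) I by (simp add: M_def)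
    moreover have "v' i \<in> M i" if "i \<in> I - {j}" for i
      using v(1)[OF that] that by (simp add: M_def v'_def)
    moreover have "x = (\<Sum>i\<in>I. v' i)"
      using sum.remove[OF I, of v'] rest by (simp add: v'_def)
    ultimately show "\<exists>v. (\<forall>i\<in>I. v i \<in> M i) \<and> x = (\<Sum>i\<in>I. v i)" by blast
  qed
qed

text \<open>
  The passage from a cover for \<open>R\<close> to one for \<open>S\<close> with a single member \<open>W\<^sub>j\<close> around \<open>0\<close>. The last
  property undoes both alterations of \<open>V\<^sub>j\<close>: the disc that \<open>W\<^sub>j\<close> may have gained, and the point \<open>0\<close>
  that may enter the spectrum when \<open>N\<^sub>j\<close> is replaced by \<open>P\<^sup>-\<^sup>1(N\<^sub>j)\<close>. The inclusion \<open>W\<^sub>j \<subseteq> V\<^sub>j\<close> may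
  fail, which is why this property speaks of spectra of closed invariant subspaces.
\<close>

lemma refine_cover:
  assumes V: "\<And>i. i \<in> I \<Longrightarrow> open (V i)" "(\<Union>i\<in>I. V i) = UNIV" "k \<in> I" "spectrum R - U \<subseteq> V k"
  obtains W j where "j \<in> I"
    "\<forall>i\<in>I. open (W i)" "(\<Union>i\<in>I. W i) = UNIV" "spectrum S - U \<subseteq> W k"
    "\<forall>i\<in>I - {j}. 0 \<notin> W i \<and> W i \<subseteq> V i"
    "\<forall>M. closed_invariant_subspace R M \<and> spectrum_on M R \<subseteq> W j \<union> {0} \<longrightarrow> spectrum_on M R \<subseteq> V j"
proof -
  have swap: "power_factorization S R Q P m"
    by (rule power_factorization_swap) (rule power_factorization_axioms)
  have S_R: "spectrum S \<subseteq> spectrum R \<union> {0}"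
    by (rule power_factorization.spectrum_on_subset[OF swap]) auto
  obtain l where l: "l \<in> I" "0 \<in> V l" using V(2) by blast
  show thesis
  proof (cases "0 \<in> V k \<or> 0 \<notin> spectrum S - U")
    case True
    define j where "j = (if 0 \<in> V k then k else l)"
    have j: "j \<in> I" "0 \<in> V j" using l V(3) by (auto simp: j_def)
    show thesis
    proof (rule that[of j "\<lambda>i. if i = j then V i else V i - {0}"])
      show "(\<Union>i\<in>I. if i = j then V i else V i - {0}) = UNIV"
      proof -
        have "z \<in> (\<Union>i\<in>I. if i = j then V i else V i - {0})" for z
        proof (cases "z = 0")
          case False
          obtain i where "i \<in> I" "z \<in> V i" using V(2) by blast
          with False show ?thesis by (intro UN_I[of i]) auto
        qed (use j in \<open>intro UN_I[of j], auto\<close>)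
        then show ?thesis by blast
      qed
      show "spectrum S - U \<subseteq> (if k = j then V k else V k - {0})"
        using S_R V(4) True by (auto simp: j_def)
    qed (use j V(1) in \<open>auto split: if_splits\<close>)
  next
    case False
    then have zero: "0 \<notin> spectrum R" and kl: "0 \<notin> V k" using V(4) by auto
    obtain r where r: "r > 0" "ball 0 r \<subseteq> V l"
      using V(1)[OF l(1)] l(2) by (auto simp: open_contains_ball)
    obtain \<delta> where \<delta>: "0 < \<delta>" "\<delta> < r" "sphere 0 \<delta> \<inter> spectrum R = {}"
      "\<forall>M. closed_invariant_subspace R M \<and> \<not> sphere 0 \<delta> \<subseteq> spectrum_on M R \<longrightarrow>
        cball 0 \<delta> \<inter> spectrum_on M R = {}"
      by (rule exceptional_disc[OF bounded(1) zero r(1)])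
    \<comment> \<open>The removed circle remains covered by \<open>V\<^sub>l\<close>, which contains the ball of radius \<open>r > \<delta>\<close>.\<close>
    define Wk where "Wk = (V k - sphere 0 \<delta>) \<union> ball 0 \<delta>"
    define W where "W i = (if i = k then Wk else V i - {0})" for i
    have kl': "k \<noteq> l" using kl l by blast
    show thesis
    proof (rule that[of k W])
      show "\<forall>i\<in>I. open (W i)"
        using V(1) by (auto simp: W_def Wk_def intro!: open_Un open_Diff)
      show "(\<Union>i\<in>I. W i) = UNIV"
      proof -
        have "z \<in> (\<Union>i\<in>I. W i)" for z
        proof -
          consider "cmod z < \<delta>" | "cmod z = \<delta>" | "cmod z > \<delta>" by linarith
          then show ?thesis
          proof cases
            case 1
            then show ?thesis using V(3) by (intro UN_I[of k]) (auto simp: W_def Wk_def)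
          next
            case 2
            then show ?thesis using l \<delta> r kl' by (intro UN_I[of l]) (auto simp: W_def)
          next
            case 3
            obtain i where "i \<in> I" "z \<in> V i" using V(2) by blast
            with 3 \<delta>(1) show ?thesis by (intro UN_I[of i]) (auto simp: W_def Wk_def)
          qed
        qed
        then show ?thesis by blast
      qed
      show "spectrum S - U \<subseteq> W k"
        using S_R V(4) \<delta>(1,3) by (auto simp: W_def Wk_def)
      show "\<forall>M. closed_invariant_subspace R M \<and> spectrum_on M R \<subseteq> W k \<union> {0} \<longrightarrow>
        spectrum_on M R \<subseteq> V k"
      proof (intro allI impI, elim conjE)
        fix M assume M: "closed_invariant_subspace R M" "spectrum_on M R \<subseteq> W k \<union> {0}"
        \<comment> \<open>The circle is not empty, and no point of it can lie in the spectrum of \<open>R|M\<close>.\<close>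
        have "of_real \<delta> \<in> sphere (0::complex) \<delta>" using \<delta>(1) by simp
        moreover have "sphere 0 \<delta> \<inter> spectrum_on M R = {}"
          using M(2) \<delta>(1) by (auto simp: W_def Wk_def)
        ultimately have "cball 0 \<delta> \<inter> spectrum_on M R = {}"
          using \<delta>(4) M(1) by blast
        moreover have "W k \<union> {0} \<subseteq> V k \<union> cball 0 \<delta>"
          using \<delta>(1) by (auto simp: W_def Wk_def)
        ultimately show "spectrum_on M R \<subseteq> V k" using M(2) by blast
      qed
    qed (use V(3) in \<open>auto simp: W_def\<close>)
  qed
qed

lemma decomposable_on_transfer:
  assumes S: "decomposable_on S U"
  shows "decomposable_on R U"
  unfolding decomposable_on_def
proof (intro allI impI)
  fix n :: nat and V
  assume "n \<ge> 1 \<and> (\<forall>i\<in>{1..n}. open (V i)) \<and> (\<Union>i\<in>{1..n}. V i) = UNIV \<and> spectrum R - U \<subseteq> V 1"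
  then have n: "n \<ge> 1" and V: "\<And>i. i \<in> {1..n} \<Longrightarrow> open (V i)" "(\<Union>i\<in>{1..n}. V i) = UNIV"
    "1 \<in> {1..n}" "spectrum R - U \<subseteq> V 1" by auto
  obtain W j where j: "j \<in> {1..n}"
    and W: "\<forall>i\<in>{1..n}. open (W i)" "(\<Union>i\<in>{1..n}. W i) = UNIV" "spectrum S - U \<subseteq> W 1"
    and WV: "\<forall>i\<in>{1..n} - {j}. 0 \<notin> W i \<and> W i \<subseteq> V i"
    and WVj: "\<forall>M. closed_invariant_subspace R M \<and> spectrum_on M R \<subseteq> W j \<union> {0} \<longrightarrow>
      spectrum_on M R \<subseteq> V j"
    by (rule refine_cover[OF V])
  have "\<exists>N. (\<forall>i\<in>{1..n}. closed_invariant_subspace S (N i) \<and> spectrum_on (N i) S \<subseteq> W i) \<and>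
      {\<Sum>i\<in>{1..n}. x i | x. \<forall>i\<in>{1..n}. x i \<in> N i} = UNIV"
    by (rule S[unfolded decomposable_on_def, rule_format, of n W]) (use n W in simp)
  then obtain N where
    N_all: "\<forall>i\<in>{1..n}. closed_invariant_subspace S (N i) \<and> spectrum_on (N i) S \<subseteq> W i"
    and sum_N: "{\<Sum>i\<in>{1..n}. x i | x. \<forall>i\<in>{1..n}. x i \<in> N i} = UNIV"
    by blast
  have N: "closed_invariant_subspace S (N i)" "spectrum_on (N i) S \<subseteq> W i" if "i \<in> {1..n}" for i
    using N_all that by blast+
  have sum_N': "\<exists>u. (\<forall>i\<in>{1..n}. u i \<in> N i) \<and> y = (\<Sum>i\<in>{1..n}. u i)" for y
    using sum_N by blast
  have zero': "0 \<notin> spectrum_on (N i) S" if "i \<in> {1..n} - {j}" for i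
    using WV N(2) that by blast
  obtain M where M: "\<forall>i\<in>{1..n}. closed_invariant_subspace R (M i)"
    "\<forall>i\<in>{1..n} - {j}. spectrum_on (M i) R \<subseteq> spectrum_on (N i) S"
    "spectrum_on (M j) R \<subseteq> spectrum_on (N j) S \<union> {0}"
    "\<forall>x. \<exists>v. (\<forall>i\<in>{1..n}. v i \<in> M i) \<and> x = (\<Sum>i\<in>{1..n}. v i)"
    by (rule pull_back_decomposition[OF finite_atLeastAtMost j N(1) zero' sum_N'])
  have "spectrum_on (M i) R \<subseteq> V i" if i: "i \<in> {1..n}" for i
  proof (cases "i = j")
    case True
    show ?thesis unfolding True using M(1,3) N(2) j WVj by blast
  next
    case False
    then have "i \<in> {1..n} - {j}" using i by blast
    then show ?thesis using M(2) N(2) WV i by blast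
  qed
  moreover have "{\<Sum>i\<in>{1..n}. x i | x. \<forall>i\<in>{1..n}. x i \<in> M i} = UNIV"
    using M(4) by blast
  ultimately show "\<exists>M. (\<forall>i\<in>{1..n}. closed_invariant_subspace R (M i) \<and> spectrum_on (M i) R \<subseteq> V i) \<and>
    {\<Sum>i\<in>{1..n}. x i | x. \<forall>i\<in>{1..n}. x i \<in> M i} = UNIV"
    using M(1) by (intro exI[of _ M]) simp
qed

end

theorem corollary2p4:
  fixes A :: "'x::cbanach \<Rightarrow> 'y::cbanach"
    and B C :: "'y \<Rightarrow> 'x"
  assumes "bounded_clinear A" and "bounded_clinear B" and "bounded_clinear C"
    and "A \<circ> (B \<circ> A) ^^ 2 = A \<circ> B \<circ> A \<circ> C \<circ> A"
    and "A \<circ> B \<circ> A \<circ> C \<circ> A = A \<circ> C \<circ> A \<circ> B \<circ> A"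
    and "A \<circ> C \<circ> A \<circ> B \<circ> A = (A \<circ> C) ^^ 2 \<circ> A"
  shows "sigma_dec (A \<circ> C) = sigma_dec (B \<circ> A) \<and>
         (decomposable (A \<circ> C) \<longleftrightarrow> decomposable (B \<circ> A))"
proof -
  have rel: "A (B (A (B (A x)))) = A (C (A (C (A x))))"
    "A (B (A (C (A x)))) = A (C (A (C (A x))))"
    "A (C (A (B (A x)))) = A (C (A (C (A x))))" for x
    using fun_cong[OF assms(4), of x] fun_cong[OF assms(5), of x] fun_cong[OF assms(6), of x]
    by (simp_all add: numeral_2_eq_2)
  \<comment> \<open>The shorter candidate \<open>BAC\<close> in place of \<open>BACAC\<close> would require \<open>BABAC = BACAC\<close>, while the
    hypotheses only identify words with three factors \<open>A\<close> that begin and end in \<open>A\<close>.\<close>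
  have fac: "power_factorization (B \<circ> A) (A \<circ> C) (A \<circ> C \<circ> A) (B \<circ> A \<circ> C \<circ> A \<circ> C) 4"
    by unfold_locales
      (auto simp: rel numeral_eq_Suc intro!: bounded_clinear_comp assms(1-3))
  have "decomposable_on (A \<circ> C) U \<longleftrightarrow> decomposable_on (B \<circ> A) U" for U
    using power_factorization.decomposable_on_transfer[OF fac]
      power_factorization.decomposable_on_transfer[OF power_factorization_swap[OF fac]] by blast
  then have "sigma_dec (A \<circ> C) = sigma_dec (B \<circ> A)"
    by (simp add: sigma_dec_def rho_dec_def)
  then show ?thesis by (simp add: decomposable_def)
qed

end
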